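(* Let $(g,\lambda,1)$ be an orthosymmetric real type. The set $\mathcal O_{g,\lambda,1}\subset\mathbb Z_2^g$ is invariant for the action $\mathfrak A$ of $\mathbb G_{g,\lambda,1}$ on $\mathbb Z_2^g$. The same is true for the set $\mathcal E_{g,\lambda,1}$.
   Context: An orthosymmetric real type is a triple $(g,\lambda,1)$ of integers with $g\ge1$, $0\le\lambda\le g$ and $\lambda$ even; write $\lambda=2\lambda_0$. Let $M=M_{g,\lambda,1}$ be the $g\times g$ matrix $\begin{bmatrix} M_{\lambda,\lambda,1}&0\\0&0\end{bmatrix}$ with $M_{\lambda,\lambda,1}=\begin{bmatrix}0&\mathrm{Id}_{\lambda_0}\\ \mathrm{Id}_{\lambda_0}&0\end{bmatrix}$. The real modular group is $$\mathbb G_{g,\lambda,1}=\left\{G=\begin{bmatrix}A&\tfrac12(M-AMA^{\top})(A^{\top})^{-1}\\0&(A^{\top})^{-1}\end{bmatrix}: A\in \mathrm{GL}(g,\mathbb Z),\ M\equiv AMA^{\top}\bmod 2\right\}.$$ It acts on $\mathbb Z_2^g$ by $\mathfrak A(G,[\beta]_2)=[A\beta-\tfrac12\mathrm{diag}(M-AMA^{\top})]_2$, where $\mathrm{diag}(\cdot)$ is the vector of diagonal entries and $[\cdot]_2$ is the class modulo 2. The sets are $$\mathcal O_{g,\lambda,1}=\{[\beta]_2\in\mathbb Z_2^g:\ \beta^{\top}M\beta\equiv2\bmod 4,\ \beta_{\lambda+1}\equiv\dots\equiv\beta_g\equiv0\bmod 2\},$$ $$\mathcal E_{g,\lambda,1}=\{[\beta]_2\in\mathbb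 Z_2^g:\ \beta^{\top}M\beta\equiv0\bmod 4,\ \beta_{\lambda+1}\equiv\dots\equiv\beta_g\equiv0\bmod 2\}.$$ *)

theory Defs
  imports
    "Jordan_Normal_Form.Matrix"
    "HOL-Number_Theory.Cong"
    "HOL-Library.Z2"
begin

text \<open>
  All real types \<open>(g, \<lambda>, a)\<close> below have \<open>a = 1\<close>, so only \<open>g\<close> and \<open>\<lambda>\<close> (written \<open>l\<close>) occur as
  parameters. Matrix and vector indices start at 0, and \<open>\<int>\<^sub>2\<^sup>g\<close> is \<open>carrier_vec g :: bit vec set\<close>.
\<close>

definition orthosymmetric_real_type :: "nat \<Rightarrow> nat \<Rightarrow> bool" where
  "orthosymmetric_real_type g l \<longleftrightarrow> g \<ge> 1 \<and> l \<le> g \<and> even l"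

definition swap_mat :: "nat \<Rightarrow> int mat" where
  "swap_mat k = four_block_mat (0\<^sub>m k k) (1\<^sub>m k) (1\<^sub>m k) (0\<^sub>m k k)"

definition real_type_mat :: "nat \<Rightarrow> nat \<Rightarrow> int mat" where
  "real_type_mat g l = four_block_mat (swap_mat (l div 2)) (0\<^sub>m l (g - l))
                                      (0\<^sub>m (g - l) l)      (0\<^sub>m (g - l) (g - l))"

abbreviation GL_int :: "nat \<Rightarrow> int mat set" where
  "GL_int g \<equiv> Units (ring_mat TYPE(int) g ())"

abbreviation mat_inv :: "nat \<Rightarrow> int mat \<Rightarrow> int mat" where
  "mat_inv g A \<equiv> inv\<^bsub>ring_mat TYPE(int) g ()\<^esub> A"

definition mat_cong :: "int mat \<Rightarrow> int mat \<Rightarrow> int \<Rightarrow> bool" where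
  "mat_cong A B m \<longleftrightarrow> dim_row A = dim_row B \<and> dim_col A = dim_col B \<and>
     (\<forall>i < dim_row A. \<forall>j < dim_col A. [A $$ (i, j) = B $$ (i, j)] (mod m))"

definition class2 :: "int vec \<Rightarrow> bit vec" where
  "class2 v = map_vec of_int v"

text \<open>
  The matrix \<open>(M - A M A\<^sup>T) / 2\<close>. It is only used for \<open>A\<close> with \<open>M \<equiv> A M A\<^sup>T\<close> modulo 2, for which
  the integer division below is exact.
\<close>

definition half_diff :: "nat \<Rightarrow> nat \<Rightarrow> int mat \<Rightarrow> int mat" where
  "half_diff g l A =
     map_mat (\<lambda>x. x div 2) (real_type_mat g l - A * real_type_mat g l * transpose_mat A)"

definition real_modular_mat :: "nat \<Rightarrow> nat \<Rightarrow> int mat \<Rightarrow> int mat" where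
  "real_modular_mat g l A =
     four_block_mat A          (half_diff g l A * mat_inv g (transpose_mat A))
                    (0\<^sub>m g g)  (mat_inv g (transpose_mat A))"

definition real_modular_group :: "nat \<Rightarrow> nat \<Rightarrow> int mat set" where
  "real_modular_group g l =
     {real_modular_mat g l A | A. A \<in> GL_int g \<and>
        mat_cong (real_type_mat g l) (A * real_type_mat g l * transpose_mat A) 2}"

definition upper_left :: "nat \<Rightarrow> int mat \<Rightarrow> int mat" where
  "upper_left g G = fst (split_block G g g)"

text \<open>
  The action is defined on a class through an arbitrary integer representative; the result does
  not depend on the choice, see \<open>real_modular_action_class2\<close>.
\<close>

definition real_modular_action :: "nat \<Rightarrow> nat \<Rightarrow> int mat \<Rightarrow> bit vec \<Rightarrow> bit vec" where
  "real_modular_action g l G b =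
     (let A = upper_left g G; \<beta> = (SOME \<beta>. \<beta> \<in> carrier_vec g \<and> class2 \<beta> = b)
      in class2 (A *\<^sub>v \<beta> - vec g (\<lambda>i. half_diff g l A $$ (i, i))))"

definition O_set :: "nat \<Rightarrow> nat \<Rightarrow> bit vec set" where
  "O_set g l = {class2 \<beta> | \<beta>. \<beta> \<in> carrier_vec g \<and>
     [\<beta> \<bullet> (real_type_mat g l *\<^sub>v \<beta>) = 2] (mod 4) \<and> (\<forall>i\<in>{l..<g}. [\<beta> $ i = 0] (mod 2))}"

definition E_set :: "nat \<Rightarrow> nat \<Rightarrow> bit vec set" where
  "E_set g l = {class2 \<beta> | \<beta>. \<beta> \<in> carrier_vec g \<and>
     [\<beta> \<bullet> (real_type_mat g l *\<^sub>v \<beta>) = 0] (mod 4) \<and> (\<forall>i\<in>{l..<g}. [\<beta> $ i = 0] (mod 2))}"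

lemma GL_int_carrier: "A \<in> GL_int g \<Longrightarrow> A \<in> carrier_mat g g"
  by (auto simp: Units_def ring_mat_def)

lemma GL_int_transpose:
  assumes "A \<in> GL_int g"
  shows "transpose_mat A \<in> GL_int g"
proof -
  obtain B where A: "A \<in> carrier_mat g g" and B: "B \<in> carrier_mat g g"
    and AB: "A * B = 1\<^sub>m g" "B * A = 1\<^sub>m g"
    using assms by (auto simp: Units_def ring_mat_def)
  have "transpose_mat A * transpose_mat B = 1\<^sub>m g" "transpose_mat B * transpose_mat A = 1\<^sub>m g"
    using transpose_mult[OF A B, symmetric] transpose_mult[OF B A, symmetric] AB by simp_all
  then show ?thesis
    using A B by (auto simp: Units_def ring_mat_def intro!: bexI[of _ "transpose_mat B"])
qed

lemma mat_inv_carrier: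
  assumes "A \<in> GL_int g"
  shows "mat_inv g A \<in> carrier_mat g g"
proof -
  interpret R: semiring "ring_mat TYPE(int) g ()" by (rule semiring_mat)
  show ?thesis using R.Units_inv_closed[OF assms] by (simp add: ring_mat_def)
qed

lemma upper_left_real_modular_mat:
  assumes "A \<in> GL_int g"
  shows "upper_left g (real_modular_mat g l A) = A"
  using GL_int_carrier[OF assms] mat_inv_carrier[OF GL_int_transpose[OF assms]]
  by (auto simp: upper_left_def split_block_def Let_def real_modular_mat_def)

lemma of_int_bit_eq_iff: "(of_int x :: bit) = of_int y \<longleftrightarrow> [x = y] (mod 2)"
proof -
  have *: "(of_int z :: bit) = 0 \<longleftrightarrow> even z" for z :: int
    by (cases "even z") (auto elim!: evenE oddE)
  have "(of_int x :: bit) = of_int y \<longleftrightarrow> (of_int (x - y) :: bit) = 0"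
    by (simp only: of_int_diff right_minus_eq)
  then show ?thesis
    unfolding * by (simp add: cong_iff_dvd_diff)
qed

lemma class2_eq_iff:
  assumes "v \<in> carrier_vec n" "w \<in> carrier_vec n"
  shows "class2 v = class2 w \<longleftrightarrow> (\<forall>i<n. [v $ i = w $ i] (mod 2))"
  using assms unfolding class2_def by (auto simp: vec_eq_iff of_int_bit_eq_iff)

lemma real_modular_action_class2:
  assumes A: "A \<in> GL_int g" and \<beta>: "\<beta> \<in> carrier_vec g"
  shows "real_modular_action g l (real_modular_mat g l A) (class2 \<beta>) =
           class2 (A *\<^sub>v \<beta> - vec g (\<lambda>i. half_diff g l A $$ (i, i)))"
proof -
  define \<gamma> where "\<gamma> = (SOME \<gamma>. \<gamma> \<in> carrier_vec g \<and> class2 \<gamma> = class2 \<beta>)"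
  have \<gamma>: "\<gamma> \<in> carrier_vec g" "class2 \<gamma> = class2 \<beta>"
    unfolding \<gamma>_def using someI[of "\<lambda>\<gamma>. \<gamma> \<in> carrier_vec g \<and> class2 \<gamma> = class2 \<beta>" \<beta>] \<beta> by auto
  note cA = GL_int_carrier[OF A]
  have "[(A *\<^sub>v \<gamma>) $ i = (A *\<^sub>v \<beta>) $ i] (mod 2)" if "i < g" for i
    using that cA \<beta> \<gamma> unfolding class2_eq_iff[OF \<gamma>(1) \<beta>]
    by (auto simp: scalar_prod_def intro!: cong_sum cong_mult)
  then have "class2 (A *\<^sub>v \<gamma> - vec g (\<lambda>i. half_diff g l A $$ (i, i))) =
      class2 (A *\<^sub>v \<beta> - vec g (\<lambda>i. half_diff g l A $$ (i, i)))"
    using cA \<beta> \<gamma>(1) by (subst class2_eq_iff[of _ g]) (auto intro!: cong_diff)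
  then show ?thesis
    unfolding real_modular_action_def upper_left_real_modular_mat[OF A] Let_def \<gamma>_def .
qed

end

theory Submission
  imports Defs
begin

text \<open>
  Modulo 2, \<open>\<beta>\<^sup>T M \<beta> / 2\<close> is the quadratic form \<open>q(\<beta>) = \<Sum>\<^sub>i \<beta>\<^sub>i \<beta>\<^sub>i\<^sub>+\<^sub>k\<close> with \<open>k = \<lambda> / 2\<close>, and the action
  is the affine map \<open>T \<beta> = A \<beta> + c\<close>, where \<open>c\<^sub>i\<close> is the value of \<open>q\<close> at the \<open>i\<close>-th row of \<open>A\<close>. Let
  \<open>W\<close> be the space of \<open>\<beta>\<close> with vanishing coordinates after the first \<open>\<lambda>\<close>. From \<open>A M A\<^sup>T = M\<close> one
  gets \<open>T W \<subseteq> W\<close> and \<open>q(A\<^sup>T y) = q(y) + c\<^sup>T y\<close>. Taking \<open>y = M A \<beta>\<close> with \<open>\<beta> \<in> W\<close> yields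
  \<open>q(T \<beta>) = q(\<beta>) + q(c)\<close>. As \<open>T\<close> permutes \<open>W\<close>, the sum of \<open>(-1)\<^bsup>q(w)\<^esup>\<close> over \<open>w \<in> W\<close> is multiplied
  by \<open>(-1)\<^bsup>q(c)\<^esup>\<close> under \<open>T\<close> and also unchanged; being \<open>2\<^sup>k \<noteq> 0\<close>, it forces \<open>q(c) = 0\<close> (the
  invariance of the Arf invariant).
\<close>

text \<open>These rules turn ring arithmetic on bits into propositional case distinctions.\<close>

declare add_bit_eq_xor [simp del] mult_bit_eq_and [simp del]

section \<open>The hyperbolic quadratic form and its isometries\<close>

definition hyp_mat :: "nat \<Rightarrow> nat \<Rightarrow> 'a :: comm_ring_1 mat" where
  "hyp_mat g k = mat g g (\<lambda>(i, j). if i < k \<and> j = i + k \<or> j < k \<and> i = j + k then 1 else 0)"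

text \<open>This is half of the quadratic form of \<open>hyp_mat g k\<close>, written without
  division because the undivided form vanishes over \<open>bit\<close>. The polymorphic type lets
  integer data and their reductions modulo 2 share one definition.\<close>

definition hyp_form :: "nat \<Rightarrow> 'a :: comm_ring_1 vec \<Rightarrow> 'a" where
  "hyp_form k v = (\<Sum>i<k. v $ i * v $ (i + k))"

definition hyp_space :: "nat \<Rightarrow> nat \<Rightarrow> 'a :: comm_ring_1 vec set" where
  "hyp_space g k = {v \<in> carrier_vec g. \<forall>i\<in>{2 * k..<g}. v $ i = 0}"

lemma hyp_mat_carrier [simp]: "hyp_mat g k \<in> carrier_mat g g"
  by (simp add: hyp_mat_def)

lemma hyp_mat_mult_vec:
  assumes "2 * k \<le> g" "v \<in> carrier_vec g"
  shows "hyp_mat g k *\<^sub>v v =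
           vec g (\<lambda>i. if i < k then v $ (i + k) else if i < 2 * k then v $ (i - k) else 0)"
proof (rule eq_vecI)
  fix i assume "i < dim_vec (vec g (\<lambda>i. if i < k then v $ (i + k) else if i < 2 * k then v $ (i - k) else 0))"
  then have i: "i < g" by simp
  have "(hyp_mat g k *\<^sub>v v) $ i =
      (\<Sum>j<g. (if i < k \<and> j = i + k \<or> j < k \<and> i = j + k then 1 else 0) * v $ j)"
    using i assms(2) by (auto simp: hyp_mat_def scalar_prod_def atLeast0LessThan intro!: sum.cong)
  also have "\<dots> = (\<Sum>j<g. if j = (if i < k then i + k else i - k) \<and> i < 2 * k then v $ j else 0)"
    by (intro sum.cong) auto
  also have "\<dots> = (if i < k then v $ (i + k) else if i < 2 * k then v $ (i - k) else 0)"
    using i assms(1) by (cases "i < 2 * k") auto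
  finally show "(hyp_mat g k *\<^sub>v v) $ i =
      vec g (\<lambda>i. if i < k then v $ (i + k) else if i < 2 * k then v $ (i - k) else 0) $ i"
    using i by simp
qed (simp add: hyp_mat_def)

lemma sum_double_split:
  fixes f :: "nat \<Rightarrow> 'a :: comm_monoid_add"
  assumes "2 * k \<le> g" "\<And>i. 2 * k \<le> i \<Longrightarrow> i < g \<Longrightarrow> f i = 0"
  shows "(\<Sum>i<g. f i) = (\<Sum>i<k. f i + f (i + k))"
proof -
  have "(\<Sum>i<g. f i) = (\<Sum>i<k + k. f i)"
    using assms by (intro sum.mono_neutral_right) auto
  also have "\<dots> = (\<Sum>i<k. f i) + (\<Sum>i<k. f (i + k))"
    by (simp add: lessThan_atLeast0 sum.shift_bounds_nat_ivl[of f 0 k k, simplified, symmetric]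
        sum.atLeastLessThan_concat)
  finally show ?thesis by (simp add: sum.distrib)
qed

lemma scalar_prod_hyp_mat:
  assumes "2 * k \<le> g" "u \<in> carrier_vec g" "v \<in> carrier_vec g"
  shows "u \<bullet> (hyp_mat g k *\<^sub>v v) = (\<Sum>i<k. u $ i * v $ (i + k) + u $ (i + k) * v $ i)"
  using assms
  by (simp add: hyp_mat_mult_vec scalar_prod_def atLeast0LessThan, subst sum_double_split[of k])
     (auto intro!: sum.cong)

lemma scalar_prod_hyp_mat_self:
  assumes "2 * k \<le> g" "v \<in> carrier_vec g"
  shows "v \<bullet> (hyp_mat g k *\<^sub>v v) = 2 * hyp_form k v"
  using assms by (simp add: scalar_prod_hyp_mat hyp_form_def sum_distrib_left algebra_simps)

text \<open>The cross terms in each hyperbolic plane make up the bilinear form of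
  \<open>hyp_mat g k\<close>, which is thus the polarization of \<open>hyp_form k\<close> in every
  characteristic.\<close>

lemma hyp_form_add:
  assumes "2 * k \<le> g" "u \<in> carrier_vec g" "v \<in> carrier_vec g"
  shows "hyp_form k (u + v) = hyp_form k u + hyp_form k v + u \<bullet> (hyp_mat g k *\<^sub>v v)"
  using assms
  by (simp add: scalar_prod_hyp_mat hyp_form_def sum.distrib[symmetric])
     (auto intro!: sum.cong simp: algebra_simps)

text \<open>The matrix exchanges the coordinates \<open>i\<close> and \<open>i + k\<close>, so each
  product only swaps its two factors.\<close>

lemma hyp_form_hyp_mat:
  assumes "2 * k \<le> g" "v \<in> carrier_vec g"
  shows "hyp_form k (hyp_mat g k *\<^sub>v v) = hyp_form k v"
  using assms by (auto simp: hyp_form_def hyp_mat_mult_vec intro!: sum.cong)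

lemma hyp_mat_mult_vec_mem:
  assumes "2 * k \<le> g" "v \<in> carrier_vec g"
  shows "hyp_mat g k *\<^sub>v v \<in> hyp_space g k"
  using assms by (auto simp: hyp_space_def hyp_mat_mult_vec)

text \<open>The square of \<open>hyp_mat g k\<close> is the coordinate projection onto
  \<open>hyp_space g k\<close>.\<close>

lemma hyp_mat_involution:
  assumes "2 * k \<le> g" "v \<in> hyp_space g k"
  shows "hyp_mat g k *\<^sub>v (hyp_mat g k *\<^sub>v v) = v"
  using assms by (intro eq_vecI) (auto simp: hyp_space_def hyp_mat_mult_vec)

lemma hyp_form_unit_vec:
  assumes "2 * k \<le> g" "j < g"
  shows "hyp_form k (unit_vec g j) = 0"
  using assms by (auto simp: hyp_form_def unit_vec_def intro!: sum.neutral)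

text \<open>For an integer matrix \<open>A\<close> of size \<open>g\<close> with
  \<open>2 * k \<le> g\<close>, these are the halves of the diagonal entries of
  \<open>A * hyp_mat g k * transpose_mat A\<close>; this form of them survives reduction modulo
  2.\<close>

definition row_forms :: "nat \<Rightarrow> 'a :: comm_ring_1 mat \<Rightarrow> 'a vec" where
  "row_forms k A = vec (dim_row A) (\<lambda>i. hyp_form k (row A i))"

text \<open>Both sides are quadratic in \<open>y\<close> with the same polarization, so it suffices to compare
  them on unit vectors.\<close>

lemma hyp_form_transpose:
  fixes A :: "bit mat"
  assumes k: "2 * k \<le> g" and A: "A \<in> carrier_mat g g"
    and inv: "A * hyp_mat g k * transpose_mat A = hyp_mat g k"
    and y: "y \<in> carrier_vec g"
  shows "hyp_form k (transpose_mat A *\<^sub>v y) = hyp_form k y + row_forms k A \<bullet> y"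
proof -
  let ?P = "\<lambda>y. hyp_form k (transpose_mat A *\<^sub>v y) = hyp_form k y + row_forms k A \<bullet> y"
  have At: "transpose_mat A \<in> carrier_mat g g" and c: "row_forms k A \<in> carrier_vec g"
    using A by (auto simp: row_forms_def)
  have add: "?P (u + v)" if u: "u \<in> carrier_vec g" and v: "v \<in> carrier_vec g"
    and P: "?P u" "?P v" for u v
  proof -
    \<comment> \<open>Moving \<open>transpose_mat A\<close> across the scalar product and applying
      \<open>inv\<close> shows that \<open>transpose_mat A\<close> preserves the polar form, so the
      cross terms for \<open>u + v\<close> agree.\<close>
    have "(transpose_mat A *\<^sub>v u) \<bullet> (hyp_mat g k *\<^sub>v (transpose_mat A *\<^sub>v v)) =
        u \<bullet> (A *\<^sub>v (hyp_mat g k *\<^sub>v (transpose_mat A *\<^sub>v v)))"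
      using transpose_vec_mult_scalar[OF A, of "hyp_mat g k *\<^sub>v (transpose_mat A *\<^sub>v v)" u] u v At
      by (simp add: mult_mat_vec_carrier[of _ g g] comm_scalar_prod[of _ g])
    also have "A *\<^sub>v (hyp_mat g k *\<^sub>v (transpose_mat A *\<^sub>v v)) = A * hyp_mat g k * transpose_mat A *\<^sub>v v"
      using assoc_mult_mat_vec[of "A * hyp_mat g k" g g "transpose_mat A" g v]
        assoc_mult_mat_vec[of A g g "hyp_mat g k" g "transpose_mat A *\<^sub>v v"] A At v
      by (simp add: mult_carrier_mat[of _ g g] mult_mat_vec_carrier[of _ g g])
    finally show ?thesis
      using P u v At c k
      by (simp add: mult_add_distrib_mat_vec[of _ g g] mult_mat_vec_carrier[of _ g g]
          hyp_form_add[of k g] scalar_prod_add_distrib[of _ g] inv algebra_simps)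
  qed
  have unit: "?P (unit_vec g j)" if j: "j < g" for j
  proof -
    have "transpose_mat A *\<^sub>v unit_vec g j = row A j"
      using A j by (intro eq_vecI) auto
    then show ?thesis
      using j A c k by (simp add: hyp_form_unit_vec row_forms_def)
  qed
  have zero: "?P (0\<^sub>v g)"
  proof -
    have "transpose_mat A *\<^sub>v 0\<^sub>v g = 0\<^sub>v g" using At by (intro eq_vecI) auto
    then show ?thesis using k c by (simp add: hyp_form_def)
  qed
  \<comment> \<open>Induction on a bound \<open>m\<close> for the support of
    \<open>y\<close>.\<close>
  have "?P y" if "m \<le> g" "y \<in> carrier_vec g" "\<forall>i. m \<le> i \<longrightarrow> i < g \<longrightarrow> y $ i = 0" for m y
    using that
  proof (induction m arbitrary: y)
    case 0
    then have "y = 0\<^sub>v g" by (intro eq_vecI) auto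
    then show ?case using zero by simp
  next
    case (Suc m)
    show ?case
    proof (cases "y $ m = 0")
      case True
      then have "\<forall>i. m \<le> i \<longrightarrow> i < g \<longrightarrow> y $ i = 0"
        using Suc.prems by (metis Suc_leI le_neq_implies_less)
      then show ?thesis using Suc by simp
    next
      case False
      \<comment> \<open>A nonzero bit is 1, so adding the unit vector clears coordinate
        \<open>m\<close>; adding it once more restores \<open>y\<close>.\<close>
      define z where "z = y + unit_vec g m"
      have z: "z \<in> carrier_vec g" using Suc.prems by (simp add: z_def)
      have "\<forall>i. m \<le> i \<longrightarrow> i < g \<longrightarrow> z $ i = 0"
        using Suc.prems False unfolding z_def
        by (auto simp: unit_vec_def Suc_le_eq)
      then have "?P z" using Suc z by simp
      moreover have "y = z + unit_vec g m"
        using Suc.prems by (intro eq_vecI) (auto simp: z_def add.assoc)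
      ultimately show ?thesis using add[OF z, of "unit_vec g m"] unit[of m] Suc.prems by simp
    qed
  qed
  from this[of g y] y show ?thesis by simp
qed

section \<open>The Gauss sum of the hyperbolic form\<close>

definition bit_sign :: "bit \<Rightarrow> int" where
  "bit_sign b = (if b = 0 then 1 else -1)"

lemma bit_sign_add: "bit_sign (a + b) = bit_sign a * bit_sign b"
  by (cases a; cases b) (auto simp: bit_sign_def)

lemma bit_sign_sum: "bit_sign (\<Sum>i\<in>I. f i) = (\<Prod>i\<in>I. bit_sign (f i))"
  by (induction I rule: infinite_finite_induct) (auto simp: bit_sign_add, auto simp: bit_sign_def)

lemma UNIV_bit: "(UNIV :: bit set) = {0, 1}"
  using bit.exhaust by blast

text \<open>A vector is encoded by its \<open>k\<close> coordinate pairs, one per hyperbolic plane,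
  so that sums over the space factor.\<close>

lemma bij_betw_hyp_space:
  assumes "2 * k \<le> g"
  shows "bij_betw (\<lambda>f. vec g (\<lambda>i. if i < k then fst (f i) else if i < 2 * k then snd (f (i - k)) else 0))
           (Pi\<^sub>E {..<k} (\<lambda>_. UNIV)) (hyp_space g k :: bit vec set)"
proof (rule bij_betw_byWitness[where f' = "\<lambda>v. \<lambda>i\<in>{..<k}. (v $ i, v $ (i + k))"])
  show "\<forall>v\<in>hyp_space g k. vec g (\<lambda>i. if i < k then fst ((\<lambda>i\<in>{..<k}. (v $ i, v $ (i + k))) i)
      else if i < 2 * k then snd ((\<lambda>i\<in>{..<k}. (v $ i, v $ (i + k))) (i - k)) else 0) = v"
    by (auto simp: hyp_space_def intro!: eq_vecI)
qed (use assms in \<open>auto simp: hyp_space_def PiE_def extensional_def fun_eq_iff\<close>)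

lemma finite_hyp_space: "2 * k \<le> g \<Longrightarrow> finite (hyp_space g k :: bit vec set)"
  using bij_betw_finite[OF bij_betw_hyp_space[of k g]] by (simp add: finite_PiE UNIV_bit flip: UNIV_Times_UNIV)

text \<open>The sum is a product over the \<open>k\<close> planes. In each plane only the pair (1,
  1) has sign -1, so each factor is 3 - 1 = 2.\<close>

lemma sum_bit_sign_hyp_form:
  assumes "2 * k \<le> g"
  shows "(\<Sum>v\<in>hyp_space g k. bit_sign (hyp_form k v)) = 2 ^ k"
proof -
  have "(\<Sum>v\<in>hyp_space g k. bit_sign (hyp_form k v)) =
      (\<Sum>f\<in>Pi\<^sub>E {..<k} (\<lambda>_. UNIV). \<Prod>i<k. bit_sign (fst (f i) * snd (f i)))"
    using assms
    by (subst sum.reindex_bij_betw[OF bij_betw_hyp_space[OF assms], symmetric])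
       (auto simp: hyp_form_def bit_sign_sum intro!: sum.cong prod.cong)
  also have "\<dots> = (\<Prod>i<k. \<Sum>p\<in>UNIV. bit_sign (fst p * snd p))"
    by (subst prod_sum_PiE) (auto simp: UNIV_bit simp flip: UNIV_Times_UNIV)
  also have "\<dots> = 2 ^ k"
    by (simp add: UNIV_bit bit_sign_def flip: UNIV_Times_UNIV)
  finally show ?thesis .
qed

section \<open>The affine action on the hyperbolic space over \<open>bit\<close>\<close>

lemma affine_action_mod_2:
  fixes A B :: "bit mat"
  assumes k: "2 * k \<le> g" and A: "A \<in> carrier_mat g g" and B: "B \<in> carrier_mat g g"
    and AB: "A * B = 1\<^sub>m g" "B * A = 1\<^sub>m g"
    and inv: "A * hyp_mat g k * transpose_mat A = hyp_mat g k"
    and v: "v \<in> hyp_space g k"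
  shows "A *\<^sub>v v + row_forms k A \<in> hyp_space g k \<and>
         hyp_form k (A *\<^sub>v v + row_forms k A) = hyp_form k v"
proof -
  let ?M = "hyp_mat g k :: bit mat" and ?W = "hyp_space g k :: bit vec set"
  let ?c = "row_forms k A" and ?T = "\<lambda>w. A *\<^sub>v w + row_forms k A"
  have At: "transpose_mat A \<in> carrier_mat g g" and Bt: "transpose_mat B \<in> carrier_mat g g"
    and c: "?c \<in> carrier_vec g"
    using A B by (auto simp: row_forms_def)
  have Wc: "w \<in> carrier_vec g" if "w \<in> ?W" for w using that by (simp add: hyp_space_def)
  note carr = mult_mat_vec_carrier[of _ g g]
  have BAv: "B *\<^sub>v (A *\<^sub>v x) = x" if "x \<in> carrier_vec g" for x
    using assoc_mult_mat_vec[OF B A that] AB that by simp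
  have AtBt: "transpose_mat A *\<^sub>v (transpose_mat B *\<^sub>v x) = x" if "x \<in> carrier_vec g" for x
    using assoc_mult_mat_vec[OF At Bt that] transpose_mult[OF B A, symmetric] AB that by simp
  have invv: "A *\<^sub>v (?M *\<^sub>v (transpose_mat A *\<^sub>v x)) = ?M *\<^sub>v x" if x: "x \<in> carrier_vec g" for x
    using assoc_mult_mat_vec[of "A * ?M" g g "transpose_mat A" g x]
      assoc_mult_mat_vec[of A g g ?M g "transpose_mat A *\<^sub>v x"] A At x
    by (simp add: mult_carrier_mat[of _ g g] carr inv)
  have AW: "A *\<^sub>v w \<in> ?W" if w: "w \<in> ?W" for w
  proof -
    \<comment> \<open>Chosen so that \<open>transpose_mat A\<close> sends \<open>?x\<close> to
      \<open>?M *\<^sub>v w\<close>; then \<open>invv\<close> puts \<open>A *\<^sub>v w\<close> into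
      the image of \<open>?M\<close>.\<close>
    let ?x = "transpose_mat B *\<^sub>v (?M *\<^sub>v w)"
    have Mw: "?M *\<^sub>v w \<in> carrier_vec g" and x: "?x \<in> carrier_vec g"
      using Wc[OF w] Bt by (simp_all add: carr)
    have "A *\<^sub>v w = ?M *\<^sub>v ?x"
      using invv[OF x] by (simp add: AtBt[OF Mw] hyp_mat_involution[OF k w])
    then show ?thesis using hyp_mat_mult_vec_mem[OF k x] by simp
  qed
  have cW: "?c \<in> ?W"
  proof -
    \<comment> \<open>Row \<open>i\<close> is the image of the unit vector under
      \<open>transpose_mat A\<close>. As \<open>?M\<close> kills this unit vector,
      \<open>invv\<close> and the injectivity of \<open>A\<close> show that \<open>?M\<close> kills
      the row, and \<open>?M\<close> preserves \<open>hyp_form k\<close>.\<close>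
    have "hyp_form k (row A i) = 0" if i: "i \<in> {2 * k..<g}" for i
    proof -
      have r: "row A i \<in> carrier_vec g" and e: "(unit_vec g i :: bit vec) \<in> carrier_vec g"
        using A by auto
      have "transpose_mat A *\<^sub>v unit_vec g i = row A i"
        using A i by (intro eq_vecI) auto
      moreover have "?M *\<^sub>v unit_vec g i = 0\<^sub>v g"
        using i k by (intro eq_vecI) (auto simp: hyp_mat_mult_vec unit_vec_def)
      ultimately have "A *\<^sub>v (?M *\<^sub>v row A i) = 0\<^sub>v g" using invv[OF e] by simp
      then have "?M *\<^sub>v row A i = B *\<^sub>v 0\<^sub>v g" using BAv[of "?M *\<^sub>v row A i"] r by (simp add: carr)
      also have "\<dots> = 0\<^sub>v g" using B by (intro eq_vecI) auto
      finally have "hyp_form k (row A i) = hyp_form k (0\<^sub>v g :: bit vec)"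
        using hyp_form_hyp_mat[OF k r] by simp
      then show ?thesis using k by (simp add: hyp_form_def)
    qed
    then show ?thesis using A by (auto simp: hyp_space_def row_forms_def)
  qed
  have TW: "?T w \<in> ?W" if "w \<in> ?W" for w
    using AW[OF that] cW by (auto simp: hyp_space_def)
  have shift: "hyp_form k (?T w) = hyp_form k w + hyp_form k ?c" if w: "w \<in> ?W" for w
  proof -
    \<comment> \<open>With this choice \<open>?M *\<^sub>v ?z = w\<close>, so \<open>?z\<close> and
      \<open>w\<close> have the same form; the linear term \<open>?c \<bullet> ?y\<close> is exactly
      the polar term of \<open>?c\<close> and \<open>A *\<^sub>v w\<close>.\<close>
    let ?y = "?M *\<^sub>v (A *\<^sub>v w)"
    let ?z = "transpose_mat A *\<^sub>v ?y"
    have Aw: "A *\<^sub>v w \<in> carrier_vec g" using AW[OF w] by (rule Wc)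
    then have y: "?y \<in> carrier_vec g" by (simp add: carr)
    then have z: "?z \<in> carrier_vec g" using At by (simp add: carr)
    have "A *\<^sub>v (?M *\<^sub>v ?z) = A *\<^sub>v w"
      using invv[OF y] hyp_mat_involution[OF k AW[OF w]] by simp
    then have "?M *\<^sub>v ?z = w" using BAv[of "?M *\<^sub>v ?z"] BAv[OF Wc[OF w]] z by (simp add: carr)
    then have "hyp_form k w = hyp_form k ?z" using hyp_form_hyp_mat[OF k z] by simp
    also have "\<dots> = hyp_form k (A *\<^sub>v w) + ?c \<bullet> ?y"
      using hyp_form_transpose[OF k A inv y] hyp_form_hyp_mat[OF k Aw] by simp
    finally show ?thesis
      using hyp_form_add[OF k c Aw] Aw c
      by (simp add: comm_add_vec[of "A *\<^sub>v w" g] algebra_simps)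
  qed
  have "hyp_form k ?c = 0"
  proof -
    have "inj_on ?T ?W"
    proof (rule inj_onI)
      fix u w assume u: "u \<in> ?W" and w: "w \<in> ?W" and eq: "?T u = ?T w"
      have "A *\<^sub>v u = A *\<^sub>v w"
      proof (rule eq_vecI)
        fix i assume "i < dim_vec (A *\<^sub>v w)"
        then have i: "i < g" using A by simp
        have "?T u $ i = ?T w $ i" using eq by simp
        then show "(A *\<^sub>v u) $ i = (A *\<^sub>v w) $ i" using i A c by auto
      qed simp
      then show "u = w" using BAv[OF Wc[OF u]] BAv[OF Wc[OF w]] by argo
    qed
    moreover have "?T ` ?W \<subseteq> ?W" using TW by blast
    ultimately have "bij_betw ?T ?W ?W"
      using endo_inj_surj[OF finite_hyp_space[OF k]] unfolding bij_betw_def by blast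
    from sum.reindex_bij_betw[OF this, of "\<lambda>v. bit_sign (hyp_form k v)"]
    have "(\<Sum>w\<in>?W. bit_sign (hyp_form k w)) * bit_sign (hyp_form k ?c) =
        (\<Sum>w\<in>?W. bit_sign (hyp_form k w))"
      by (simp add: shift bit_sign_add sum_distrib_right)
    \<comment> \<open>The sum can be cancelled because it is the nonzero integer
      \<open>2 ^ k\<close>.\<close>
    then have "bit_sign (hyp_form k ?c) = 1" by (simp add: sum_bit_sign_hyp_form[OF k])
    then show ?thesis by (simp add: bit_sign_def split: if_splits)
  qed
  then show ?thesis using TW[OF v] shift[OF v] by simp
qed

section \<open>From integer representatives to classes modulo 2\<close>

lemma real_type_mat_eq_hyp_mat:
  assumes "even l" "l \<le> g"
  shows "real_type_mat g l = hyp_mat g (l div 2)"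
proof -
  obtain k where l: "l = 2 * k" using assms(1) by (rule evenE)
  show ?thesis
    using assms(2) unfolding l
    by (intro eq_matI) (auto simp: real_type_mat_def swap_mat_def hyp_mat_def)
qed

lemma class2_carrier [simp]: "class2 v \<in> carrier_vec g \<longleftrightarrow> v \<in> carrier_vec g"
  unfolding class2_def by (rule map_carrier_vec)

lemma hyp_form_class2:
  assumes "2 * k \<le> dim_vec v"
  shows "hyp_form k (class2 v) = of_int (hyp_form k v)"
  using assms by (simp add: hyp_form_def class2_def)

lemma of_int_bit_eq_0_iff: "(of_int x :: bit) = 0 \<longleftrightarrow> [x = 0] (mod 2)"
  using of_int_bit_eq_iff[of x 0] by (simp only: of_int_0)

text \<open>The integer form is twice \<open>hyp_form\<close>, so its value modulo 4 amounts to the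
  value of \<open>hyp_form\<close> modulo 2, which depends only on the class. The values 1 and 0 of
  \<open>t\<close> give \<open>O_set\<close> and \<open>E_set\<close>.\<close>

lemma level_set_class2:
  assumes "even l" "l \<le> g"
  shows "{class2 \<beta> | \<beta>. \<beta> \<in> carrier_vec g \<and> [\<beta> \<bullet> (real_type_mat g l *\<^sub>v \<beta>) = 2 * t] (mod 4) \<and>
            (\<forall>i\<in>{l..<g}. [\<beta> $ i = 0] (mod 2))} =
         {class2 \<beta> | \<beta>. class2 \<beta> \<in> hyp_space g (l div 2) \<and>
            hyp_form (l div 2) (class2 \<beta>) = of_int t}"
proof -
  have "[2 * x = 2 * t] (mod 4) \<longleftrightarrow> [x = t] (mod 2)" for x :: int
    unfolding cong_iff_dvd_diff by presburger
  moreover have k: "2 * (l div 2) = l" "2 * (l div 2) \<le> g" using assms by auto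
  ultimately have "\<beta> \<in> carrier_vec g \<and> [\<beta> \<bullet> (real_type_mat g l *\<^sub>v \<beta>) = 2 * t] (mod 4) \<and>
            (\<forall>i\<in>{l..<g}. [\<beta> $ i = 0] (mod 2)) \<longleftrightarrow>
       class2 \<beta> \<in> hyp_space g (l div 2) \<and> hyp_form (l div 2) (class2 \<beta>) = of_int t" for \<beta>
    using assms
    by (cases "\<beta> \<in> carrier_vec g")
       (auto simp: real_type_mat_eq_hyp_mat scalar_prod_hyp_mat_self hyp_space_def hyp_form_class2
          of_int_bit_eq_iff, auto simp: class2_def of_int_bit_eq_0_iff)
  then show ?thesis by simp
qed

text \<open>Handles both level sets at once: the action becomes the affine map of
  \<open>affine_action_mod_2\<close> for the reduction of \<open>A\<close>. The witness
  \<open>\<gamma>\<close> matches the description of the sets by representatives.\<close>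

lemma real_modular_action_level_set:
  assumes l: "even l" "l \<le> g" and G: "G \<in> real_modular_group g l"
    and v: "class2 \<beta> \<in> hyp_space g (l div 2)"
  shows "\<exists>\<gamma>. real_modular_action g l G (class2 \<beta>) = class2 \<gamma> \<and>
           class2 \<gamma> \<in> hyp_space g (l div 2) \<and>
           hyp_form (l div 2) (class2 \<gamma>) = hyp_form (l div 2) (class2 \<beta>)"
proof -
  let ?k = "l div 2"
  let ?M = "hyp_mat g ?k :: int mat"
  let ?h = "map_mat of_int :: int mat \<Rightarrow> bit mat"
  have k: "2 * ?k \<le> g" using l by simp
  have M: "real_type_mat g l = ?M" using l by (rule real_type_mat_eq_hyp_mat)
  obtain A where GA: "G = real_modular_mat g l A" and AG: "A \<in> GL_int g"
    and cong: "mat_cong ?M (A * ?M * transpose_mat A) 2"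
    using G unfolding real_modular_group_def M by auto
  obtain B where A: "A \<in> carrier_mat g g" and B: "B \<in> carrier_mat g g"
    and AB: "A * B = 1\<^sub>m g" "B * A = 1\<^sub>m g"
    using AG by (auto simp: Units_def ring_mat_def)
  have \<beta>: "\<beta> \<in> carrier_vec g" using v by (simp add: hyp_space_def)
  have hA: "?h A \<in> carrier_mat g g" and hB: "?h B \<in> carrier_mat g g" using A B by auto
  have hAB: "?h A * ?h B = 1\<^sub>m g" "?h B * ?h A = 1\<^sub>m g"
    using of_int_hom.mat_hom_mult[OF A B, symmetric] of_int_hom.mat_hom_mult[OF B A, symmetric] AB
    by (simp_all add: of_int_hom.mat_hom_one)
  have hM: "?h ?M = hyp_mat g ?k"
    by (intro eq_matI) (auto simp: hyp_mat_def)
  have "?h (A * ?M * transpose_mat A) = ?h A * hyp_mat g ?k * transpose_mat (?h A)"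
    using A by (simp add: of_int_hom.mat_hom_mult[of _ g g _ g] hM map_mat_transpose[symmetric]
        mult_carrier_mat[of _ g g])
  moreover have "?h (A * ?M * transpose_mat A) = ?h ?M"
    using cong A unfolding mat_cong_def
    by (intro eq_matI) (auto simp: of_int_bit_eq_iff cong_sym simp del: index_mult_mat(1))
  ultimately have inv: "?h A * hyp_mat g ?k * transpose_mat (?h A) = hyp_mat g ?k"
    using hM by simp
  define d where "d = vec g (\<lambda>i. half_diff g l A $$ (i, i))"
  have d: "d \<in> carrier_vec g" by (simp add: d_def)
  \<comment> \<open>The diagonal of \<open>?M\<close> is zero and that of the transformed matrix is
    twice \<open>hyp_form\<close> of the rows, so the halving is exact.\<close>
  have "d $ i = - hyp_form ?k (row A i)" if i: "i < g" for i
  proof -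
    have r: "row A i \<in> carrier_vec g" using A by auto
    have "(A * ?M * transpose_mat A) $$ (i, i) = (A * (?M * transpose_mat A)) $$ (i, i)"
      using A by (simp add: assoc_mult_mat[of _ g g _ g _ g])
    also have "\<dots> = row A i \<bullet> col (?M * transpose_mat A) i"
      using A i by (subst index_mult_mat) (auto simp: hyp_mat_def)
    also have "col (?M * transpose_mat A) i = ?M *\<^sub>v row A i"
      using A i by (subst col_mult2[of _ g g _ g]) auto
    finally have "(A * ?M * transpose_mat A) $$ (i, i) = 2 * hyp_form ?k (row A i)"
      using scalar_prod_hyp_mat_self[OF k r] by simp
    moreover have "?M $$ (i, i) = 0" using i by (auto simp: hyp_mat_def)
    ultimately show ?thesis
      using i A by (simp add: d_def half_diff_def M del: index_mult_mat(1))
  qed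
  \<comment> \<open>Signs vanish over \<open>bit\<close>, so subtracting \<open>d\<close> becomes
    adding the row forms.\<close>
  then have "class2 (A *\<^sub>v \<beta> - d) = ?h A *\<^sub>v class2 \<beta> + row_forms ?k (?h A)"
    using A \<beta> d k
    by (intro eq_vecI)
       (auto simp: class2_def row_forms_def hyp_form_def scalar_prod_def)
  then show ?thesis
    using affine_action_mod_2[OF k hA hB hAB inv v]
    unfolding GA real_modular_action_class2[OF AG \<beta>] d_def by metis
qed

theorem theorem1p2:
  fixes g l :: nat
  assumes "orthosymmetric_real_type g l"
  shows "(\<forall>G \<in> real_modular_group g l. real_modular_action g l G ` O_set g l \<subseteq> O_set g l) \<and>
         (\<forall>G \<in> real_modular_group g l. real_modular_action g l G ` E_set g l \<subseteq> E_set g l)"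
proof -
  have l: "even l" "l \<le> g" using assms by (auto simp: orthosymmetric_real_type_def)
  have O: "O_set g l = {class2 \<beta> | \<beta>. class2 \<beta> \<in> hyp_space g (l div 2) \<and>
      hyp_form (l div 2) (class2 \<beta>) = 1}"
    using level_set_class2[OF l, of 1] by (simp add: O_set_def)
  have E: "E_set g l = {class2 \<beta> | \<beta>. class2 \<beta> \<in> hyp_space g (l div 2) \<and>
      hyp_form (l div 2) (class2 \<beta>) = 0}"
    using level_set_class2[OF l, of 0] by (simp add: E_set_def)
  show ?thesis
    unfolding O E using real_modular_action_level_set[OF l] by fastforce
qed

end
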